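(* Let $f,g:\mathbb{R}^n\to(-\infty,\infty]$, $F=f+g$, satisfy the standing assumptions listed in the context, and let $\bar x\in\mathcal{X}^\pi$. Suppose that $g$ is semi-convex around $\bar x$, that the proper separation of stationary value holds at $\bar x$ (there exists $\epsilon>0$ such that $x\in\mathcal{X}^\pi\cap\mathbb{B}(\bar x,\epsilon)$ implies $F(x)=F(\bar x)$), and that the set-valued map $$\mathcal{S}_{cano}(p):=\{x: p\in\nabla f(x)+\partial^\pi g(x)\}$$ is calm at $(0,\bar x)$. Then $F$ has the KL property at $\bar x$ with an exponent of $\frac12$.
   Context: Standing assumptions. $f,g:\mathbb{R}^n\to(-\infty,\infty]$ are proper lower semicontinuous functions, $F:=f+g$, and $\mathrm{dom}\,\phi:=\{x:\phi(x)<\infty\}$. The function $f$ is smooth on $\mathrm{dom} f$, which is assumed to be open, and $\nabla f$ is Lipschitz continuous with constant $L>0$ on a closed set $C\supseteq\mathrm{dom} f\cap\mathrm{dom} g$. The function $g$ is continuous in $\mathrm{dom} g$. $F(x)\ge F_{\min}$ for all $x\in\mathbb{R}^n$. The function $g$ is prox-bounded, meaning that $\arg\min_{x}\{g(x)+\frac1{2\gamma}\|x-a\|^2\}$ is well-defined when $\gamma$ is selected with $0<\gamma<\gamma_g$, for a certain $\gamma_g>0$. Proximal subdifferential: for $x_0\in\mathrm{dom}\,\phi$, $\partial^\pi\phi(x_0)$ is the set of $\xi$ for which there exist $\sigma,\eta>0$ with $\phi(x)\ge\phi(x_0)+\langle\xi,x-x_0\rangle-\sigma\|x-x_0\|^2$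 for all $x\in\mathbb{B}(x_0,\eta)$. Limiting subdifferential: $\partial\phi(x_0)$ is the set of $\xi$ for which there are $x_k\to x_0$ with $\phi(x_k)\to\phi(x_0)$ and $\xi_k\in\partial^\pi\phi(x_k)$ with $\xi_k\to\xi$. $\mathcal{X}^\pi:=\{x: 0\in\nabla f(x)+\partial^\pi g(x)\}$. $\mathbb{B}(x,r)$ is the open ball of radius $r$ centred at $x$. Semi-convex around $x_0\in\mathrm{dom}\,\phi$: there exist $\rho>0$ (the modulus) and $\eta>0$ such that $\phi(x)+\frac\rho2\|x\|^2$ is convex on $\mathbb{B}(x_0,\eta)$. Calmness: $\mathcal{S}:\mathbb{R}^s\rightrightarrows\mathbb{R}^d$ is calm at $(\bar p,\bar x)$, $\bar x\in\mathcal{S}(\bar p)$, if there exist neighborhoods $\mathbb{U}(\bar p)$ of $\bar p$ and $\mathbb{U}(\bar x)$ of $\bar x$ and $\kappa\ge0$ such that $\mathcal{S}(p)\cap\mathbb{U}(\bar x)\subseteq\mathcal{S}(\bar p)+\kappa\|p-\bar p\|\overline{\mathbb{B}}$ for all $p\in\mathbb{U}(\bar p)$, with $\overline{\mathbb{B}}$ the closed unit ball. KL property with an exponent of $\frac12$ at $\bar x\in\mathrm{dom}\,\phi$: there exist $\kappa,\epsilon>0$ with $\kappa(\phi(x)-\phi(\bar x))^{-1/2}\,\mathrm{dist}(0,\partial\phi(x))\ge1$ for all $x\in\mathbb{B}(\bar x,\epsilon)$ with $\phi(\bar x)<\phi(x)<+\infty$. *)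

theory Defs
  imports "HOL-Analysis.Analysis"
begin

text \<open>Functions with values in \<open>(-\<infinity>, \<infinity>]\<close> are rendered as \<open>ereal\<close>-valued functions; the
  value \<open>-\<infinity>\<close> is excluded by \<open>proper\<close>.\<close>

definition edom :: "('a \<Rightarrow> ereal) \<Rightarrow> 'a set" where
  "edom \<phi> = {x. \<phi> x < \<infinity>}"

definition proper :: "('a \<Rightarrow> ereal) \<Rightarrow> bool" where
  "proper \<phi> \<longleftrightarrow> (\<forall>x. \<phi> x \<noteq> -\<infinity>) \<and> edom \<phi> \<noteq> {}"

definition lsc :: "('a::topological_space \<Rightarrow> ereal) \<Rightarrow> bool" where
  "lsc \<phi> \<longleftrightarrow> (\<forall>x. \<phi> x \<le> Liminf (at x) \<phi>)"

text \<open>The gradient of the real-valued representative of \<open>\<phi>\<close>. It is meaningful only at points of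
  the interior of \<open>edom \<phi>\<close> where \<open>\<phi>\<close> is differentiable, so every use of it below is guarded by
  membership in \<open>edom \<phi>\<close>.\<close>

definition grad :: "('a::real_inner \<Rightarrow> ereal) \<Rightarrow> 'a \<Rightarrow> 'a" where
  "grad \<phi> x = (THE D. GDERIV (\<lambda>y. real_of_ereal (\<phi> y)) x :> D)"

text \<open>Smooth is understood as continuously differentiable.\<close>

definition smooth_on_edom :: "('a::real_inner \<Rightarrow> ereal) \<Rightarrow> bool" where
  "smooth_on_edom \<phi> \<longleftrightarrow> open (edom \<phi>) \<and>
     (\<forall>x\<in>edom \<phi>. \<exists>D. GDERIV (\<lambda>y. real_of_ereal (\<phi> y)) x :> D) \<and>
     continuous_on (edom \<phi>) (grad \<phi>)"

definition prox_bounded :: "('a::real_normed_vector \<Rightarrow> ereal) \<Rightarrow> bool" where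
  "prox_bounded \<phi> \<longleftrightarrow> (\<exists>\<gamma>0>0. \<forall>\<gamma>. 0 < \<gamma> \<and> \<gamma> < \<gamma>0 \<longrightarrow>
     (\<forall>a. {x. is_arg_min (\<lambda>y. \<phi> y + ereal (1 / (2 * \<gamma>) * (norm (y - a))\<^sup>2)) (\<lambda>_. True) x} \<noteq> {}))"

text \<open>Both subdifferentials are empty at points outside the domain.\<close>

definition prox_subdiff :: "('a::real_inner \<Rightarrow> ereal) \<Rightarrow> 'a \<Rightarrow> 'a set" where
  "prox_subdiff \<phi> x0 = {\<xi>. x0 \<in> edom \<phi> \<and> (\<exists>\<sigma>>0. \<exists>\<eta>>0. \<forall>x\<in>ball x0 \<eta>.
     \<phi> x \<ge> \<phi> x0 + ereal (inner \<xi> (x - x0) - \<sigma> * (norm (x - x0))\<^sup>2))}"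

definition lim_subdiff :: "('a::real_inner \<Rightarrow> ereal) \<Rightarrow> 'a \<Rightarrow> 'a set" where
  "lim_subdiff \<phi> x0 = {\<xi>. x0 \<in> edom \<phi> \<and> (\<exists>X \<Xi>. X \<longlonglongrightarrow> x0 \<and> (\<lambda>k. \<phi> (X k)) \<longlonglongrightarrow> \<phi> x0 \<and>
     (\<forall>k::nat. \<Xi> k \<in> prox_subdiff \<phi> (X k)) \<and> \<Xi> \<longlonglongrightarrow> \<xi>)}"

definition prox_stationary ::
    "('a::real_inner \<Rightarrow> ereal) \<Rightarrow> ('a \<Rightarrow> ereal) \<Rightarrow> 'a set" where
  "prox_stationary f g = {x \<in> edom f. 0 \<in> grad f x +o prox_subdiff g x}"

definition S_cano ::
    "('a::real_inner \<Rightarrow> ereal) \<Rightarrow> ('a \<Rightarrow> ereal) \<Rightarrow> 'a \<Rightarrow> 'a set" where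
  "S_cano f g p = {x \<in> edom f. p \<in> grad f x +o prox_subdiff g x}"

text \<open>Convexity on \<open>S\<close> of a function that does not take the value \<open>-\<infinity>\<close>; note \<open>0 * \<infinity> = 0\<close>
  in \<open>ereal\<close>, so the end points \<open>t = 0\<close> and \<open>t = 1\<close> impose nothing.\<close>

definition ereal_convex_on :: "'a::real_vector set \<Rightarrow> ('a \<Rightarrow> ereal) \<Rightarrow> bool" where
  "ereal_convex_on S \<phi> \<longleftrightarrow> convex S \<and> (\<forall>x\<in>S. \<forall>y\<in>S. \<forall>t. 0 \<le> t \<and> t \<le> 1 \<longrightarrow>
     \<phi> ((1 - t) *\<^sub>R x + t *\<^sub>R y) \<le> ereal (1 - t) * \<phi> x + ereal t * \<phi> y)"

definition semi_convex_around :: "('a::real_normed_vector \<Rightarrow> ereal) \<Rightarrow> 'a \<Rightarrow> bool" where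
  "semi_convex_around \<phi> x0 \<longleftrightarrow> x0 \<in> edom \<phi> \<and>
     (\<exists>\<rho>>0. \<exists>\<eta>>0. ereal_convex_on (ball x0 \<eta>) (\<lambda>x. \<phi> x + ereal (\<rho> / 2 * (norm x)\<^sup>2)))"

definition proper_separation ::
    "('a::real_inner \<Rightarrow> ereal) \<Rightarrow> ('a \<Rightarrow> ereal) \<Rightarrow> 'a \<Rightarrow> bool" where
  "proper_separation f g xb \<longleftrightarrow>
     (\<exists>\<epsilon>>0. \<forall>x \<in> prox_stationary f g \<inter> ball xb \<epsilon>. f x + g x = f xb + g xb)"

definition calm_at ::
    "('p::real_normed_vector \<Rightarrow> 'x::real_normed_vector set) \<Rightarrow> 'p \<Rightarrow> 'x \<Rightarrow> bool" where
  "calm_at S pb xb \<longleftrightarrow> xb \<in> S pb \<and>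
     (\<exists>U V. \<exists>\<kappa>\<ge>0. open U \<and> pb \<in> U \<and> open V \<and> xb \<in> V \<and>
       (\<forall>p\<in>U. S p \<inter> V \<subseteq> S pb + (\<lambda>b. (\<kappa> * norm (p - pb)) *\<^sub>R b) ` cball 0 1))"

text \<open>Distance to a set with the convention \<open>dist(x, {}) = \<infinity>\<close>; the library's \<open>infdist x {}\<close>
  is \<open>0\<close>, which would make the KL inequality fail wherever the subdifferential is empty.\<close>

definition einfdist :: "'a::metric_space \<Rightarrow> 'a set \<Rightarrow> ereal" where
  "einfdist x A = (INF a\<in>A. ereal (dist x a))"

definition KL_half :: "('a::real_inner \<Rightarrow> ereal) \<Rightarrow> 'a \<Rightarrow> bool" where
  "KL_half \<phi> xb \<longleftrightarrow> xb \<in> edom \<phi> \<and>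
     (\<exists>\<kappa>>0. \<exists>\<epsilon>>0. \<forall>x\<in>ball xb \<epsilon>. \<phi> xb < \<phi> x \<and> \<phi> x < \<infinity> \<longrightarrow>
       ereal (\<kappa> * real_of_ereal (\<phi> x - \<phi> xb) powr (- 1 / 2)) * einfdist 0 (lim_subdiff \<phi> x) \<ge> 1)"

end

theory Submission
  imports Defs
begin

text \<open>Near \<open>xbar\<close> a proximal subgradient \<open>\<xi>\<close> of \<open>F = f + g\<close> at \<open>x\<close> satisfies the uniform inequality
  \<open>F z \<ge> F x + \<langle>\<xi>, z - x\<rangle> - K \<parallel>z - x\<parallel>\<^sup>2\<close>, because semi-convexity makes the local subgradient inequality
  for \<open>g\<close> global with a fixed constant and \<open>f\<close> has a Lipschitz gradient. If \<open>\<xi>\<close> is small, calmness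
  yields a stationary \<open>z\<close> with \<open>\<parallel>z - x\<parallel> \<le> \<kappa> \<parallel>\<xi>\<parallel>\<close>, and \<open>F z = F xbar\<close> by proper separation; if \<open>\<xi>\<close> is
  not small, \<open>z = xbar\<close> itself is within a multiple of \<open>\<parallel>\<xi>\<parallel>\<close> of \<open>x\<close>. Either way
  \<open>F x - F xbar \<le> M \<parallel>\<xi>\<parallel>\<^sup>2\<close>, and this passes to limiting subgradients.\<close>

section \<open>Extended-real values, gradients and linearization\<close>

lemma edom_ereal_real:
  assumes "\<And>x. \<phi> x \<noteq> -\<infinity>" "x \<in> edom \<phi>"
  shows "\<phi> x = ereal (real_of_ereal (\<phi> x))"
  using assms(1)[of x] assms(2) unfolding edom_def by (cases "\<phi> x") auto

lemma edom_add:
  assumes "\<And>x. f x \<noteq> -\<infinity>" "\<And>x. g x \<noteq> -\<infinity>"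
  shows "edom (\<lambda>x. f x + g x) = edom f \<inter> edom g"
  unfolding edom_def using assms by (auto simp: less_top)

lemma real_of_ereal_add_edom:
  assumes "\<And>x. f x \<noteq> -\<infinity>" "\<And>x. g x \<noteq> -\<infinity>" "x \<in> edom f" "x \<in> edom g"
  shows "real_of_ereal (f x + g x) = real_of_ereal (f x) + real_of_ereal (g x)"
  using edom_ereal_real[of f x] edom_ereal_real[of g x] assms
  by (metis plus_ereal.simps(1) real_of_ereal.simps(1))

text \<open>The definite description in \<open>grad\<close> denotes: derivatives in the full space
  are unique, and a vector is determined by its inner products.\<close>

lemma GDERIV_grad:
  assumes "smooth_on_edom f" "x \<in> edom f"
  shows "GDERIV (\<lambda>y. real_of_ereal (f y)) x :> grad f x"
proof -
  obtain D where D: "GDERIV (\<lambda>y. real_of_ereal (f y)) x :> D"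
    using assms unfolding smooth_on_edom_def by blast
  moreover have "D' = D" if "GDERIV (\<lambda>y. real_of_ereal (f y)) x :> D'" for D'
  proof -
    have "(\<lambda>h. inner h D') = (\<lambda>h. inner h D)"
      using that D unfolding gderiv_def by (rule has_derivative_unique)
    then show ?thesis
      by (metis vector_eq_ldot)
  qed
  ultimately show ?thesis
    unfolding grad_def by (rule theI)
qed

text \<open>The mean value theorem along the segment turns the error into an inner product with a
  gradient difference, which the Lipschitz bound and Cauchy-Schwarz control. This gives
  \<open>L\<close> rather than the sharp \<open>L / 2\<close>, which is enough here. Assumptions are
  made on the segment only, since the Lipschitz bound is known on a set that may have empty
  interior.\<close>

lemma lipschitz_gradient_linearization:
  fixes h :: "'a::real_inner \<Rightarrow> real"
  assumes der: "\<And>x. x \<in> closed_segment a b \<Longrightarrow> GDERIV h x :> G x"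
    and lip: "L-lipschitz_on (closed_segment a b) G"
  shows "\<bar>h b - h a - inner (G a) (b - a)\<bar> \<le> L * (norm (b - a))\<^sup>2"
proof -
  have L0: "L \<ge> 0" using lip by (rule lipschitz_on_nonneg)
  let ?p = "\<lambda>t. a + t *\<^sub>R (b - a)"
  have seg: "?p t \<in> closed_segment a b" if "0 \<le> t" "t \<le> 1" for t
    using that by (auto simp: in_segment algebra_simps intro!: exI[of _ t])
  have "((\<lambda>t. h (?p t)) has_derivative (\<lambda>s. inner (s *\<^sub>R (b - a)) (G (?p t)))) (at t within {0..1})"
    if "t \<in> {0..1}" for t
  proof -
    have "(h has_derivative (\<lambda>v. inner v (G (?p t)))) (at (?p t))"
      using der[OF seg] that unfolding gderiv_def by simp
    moreover have "(?p has_derivative (\<lambda>s. s *\<^sub>R (b - a))) (at t within {0..1})"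
      by (auto intro!: derivative_eq_intros)
    ultimately show ?thesis
      using has_derivative_compose by blast
  qed
  then obtain s where s: "s \<in> {0<..<1}"
    "h (?p 1) - h (?p 0) = inner ((1 - 0) *\<^sub>R (b - a)) (G (?p s))"
    using mvt_simple[of 0 1 "\<lambda>t. h (?p t)" "\<lambda>t s. inner (s *\<^sub>R (b - a)) (G (?p t))"] by auto
  then have "h b - h a - inner (G a) (b - a) = inner (b - a) (G (?p s) - G a)"
    by (simp add: inner_diff_right inner_commute)
  then have "\<bar>h b - h a - inner (G a) (b - a)\<bar> \<le> norm (b - a) * norm (G (?p s) - G a)"
    by (simp add: Cauchy_Schwarz_ineq2)
  also have "norm (G (?p s) - G a) \<le> L * norm (?p s - a)"
    using lipschitz_onD[OF lip seg[of s] seg[of 0]] s by (simp add: dist_norm)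
  also have "\<dots> \<le> L * norm (b - a)"
    using s L0 by (intro mult_left_mono) (auto intro: mult_left_le_one_le)
  finally show ?thesis
    by (simp add: power2_eq_square mult_left_mono mult.left_commute)
qed

section \<open>Semi-convexity and proximal subgradients\<close>

lemma norm_convex_combination_square:
  fixes x y :: "'a::real_inner"
  shows "(norm ((1 - t) *\<^sub>R x + t *\<^sub>R y))\<^sup>2
    = (1 - t) * (norm x)\<^sup>2 + t * (norm y)\<^sup>2 - t * (1 - t) * (norm (y - x))\<^sup>2"
  unfolding power2_norm_eq_inner
  by (simp add: inner_left_distrib inner_right_distrib inner_diff_left inner_diff_right
      inner_commute algebra_simps power2_eq_square)

text \<open>The quadratics added to \<open>g\<close> cancel up to the defect in the preceding
  identity, so \<open>g\<close> is convex up to an error of order \<open>t\<close>. Finiteness of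
  the right-hand side keeps the combination in the domain, which makes \<open>edom g\<close> convex
  inside \<open>S\<close>.\<close>

lemma semi_convex_combination:
  fixes g :: "'a::real_inner \<Rightarrow> ereal"
  assumes cvx: "ereal_convex_on S (\<lambda>x. g x + ereal (\<rho> / 2 * (norm x)\<^sup>2))"
    and nm: "\<And>x. g x \<noteq> -\<infinity>"
    and x: "x \<in> S" "x \<in> edom g" and y: "y \<in> S" "y \<in> edom g" and t: "0 \<le> t" "t \<le> 1"
  shows "(1 - t) *\<^sub>R x + t *\<^sub>R y \<in> edom g"
    and "real_of_ereal (g ((1 - t) *\<^sub>R x + t *\<^sub>R y))
      \<le> (1 - t) * real_of_ereal (g x) + t * real_of_ereal (g y)
         + \<rho> / 2 * (t * (1 - t) * (norm (y - x))\<^sup>2)"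
proof -
  let ?z = "(1 - t) *\<^sub>R x + t *\<^sub>R y"
  define a b where "a = real_of_ereal (g x)" and "b = real_of_ereal (g y)"
  have gx: "g x = ereal a" and gy: "g y = ereal b"
    using edom_ereal_real[of g, OF nm] x y by (auto simp: a_def b_def)
  have le: "g ?z + ereal (\<rho> / 2 * (norm ?z)\<^sup>2)
      \<le> ereal (1 - t) * (g x + ereal (\<rho> / 2 * (norm x)\<^sup>2))
        + ereal t * (g y + ereal (\<rho> / 2 * (norm y)\<^sup>2))"
    using cvx x y t unfolding ereal_convex_on_def by blast
  then have le': "g ?z + ereal (\<rho> / 2 * (norm ?z)\<^sup>2)
      \<le> ereal ((1 - t) * (a + \<rho> / 2 * (norm x)\<^sup>2) + t * (b + \<rho> / 2 * (norm y)\<^sup>2))"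
    by (simp add: gx gy)
  show z: "?z \<in> edom g"
    using le' unfolding edom_def by (cases "g ?z") auto
  obtain c where c: "g ?z = ereal c"
    using edom_ereal_real[of g, OF nm z] by blast
  have "c + \<rho> / 2 * (norm ?z)\<^sup>2
      \<le> (1 - t) * (a + \<rho> / 2 * (norm x)\<^sup>2) + t * (b + \<rho> / 2 * (norm y)\<^sup>2)"
    using le' by (simp add: c)
  then show "real_of_ereal (g ?z) \<le> (1 - t) * real_of_ereal (g x) + t * real_of_ereal (g y)
         + \<rho> / 2 * (t * (1 - t) * (norm (y - x))\<^sup>2)"
    unfolding norm_convex_combination_square a_def[symmetric] b_def[symmetric] c
    by (simp add: algebra_simps add_divide_distrib diff_divide_distrib)
qed

lemma prox_subdiffE:
  assumes "\<xi> \<in> prox_subdiff \<phi> u" and "\<And>x. \<phi> x \<noteq> -\<infinity>"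
  obtains \<sigma> \<eta> where "\<sigma> > 0" "\<eta> > 0"
    "\<And>x. x \<in> ball u \<eta> \<Longrightarrow> x \<in> edom \<phi> \<Longrightarrow>
      real_of_ereal (\<phi> x) \<ge> real_of_ereal (\<phi> u) + inner \<xi> (x - u) - \<sigma> * (norm (x - u))\<^sup>2"
proof -
  obtain \<sigma> \<eta> where *: "\<sigma> > 0" "\<eta> > 0" "\<forall>x\<in>ball u \<eta>.
     \<phi> x \<ge> \<phi> u + ereal (inner \<xi> (x - u) - \<sigma> * (norm (x - u))\<^sup>2)" and u: "u \<in> edom \<phi>"
    using assms(1) unfolding prox_subdiff_def by blast
  have "real_of_ereal (\<phi> x) \<ge> real_of_ereal (\<phi> u) + inner \<xi> (x - u) - \<sigma> * (norm (x - u))\<^sup>2"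
    if x: "x \<in> ball u \<eta>" "x \<in> edom \<phi>" for x
  proof -
    obtain a b where "\<phi> x = ereal a" "\<phi> u = ereal b"
      using edom_ereal_real[of \<phi>, OF assms(2)] x(2) u by blast
    with *(3) x(1) show ?thesis by fastforce
  qed
  with * that show ?thesis by blast
qed

text \<open>The proximal inequality is local and its constant depends on \<open>u\<close> and
  \<open>\<zeta>\<close>. Applied at points of the segment close to \<open>u\<close> and compared
  with semi-convexity, it reaches \<open>y\<close>; the limit at \<open>u\<close> removes the local
  constant and leaves only \<open>\<rho>\<close>.\<close>

lemma semi_convex_prox_subgradient:
  fixes g :: "'a::real_inner \<Rightarrow> ereal"
  assumes cvx: "ereal_convex_on S (\<lambda>x. g x + ereal (\<rho> / 2 * (norm x)\<^sup>2))"
    and nm: "\<And>x. g x \<noteq> -\<infinity>"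
    and u: "u \<in> S" and \<zeta>: "\<zeta> \<in> prox_subdiff g u" and y: "y \<in> S" "y \<in> edom g"
  shows "real_of_ereal (g y)
    \<ge> real_of_ereal (g u) + inner \<zeta> (y - u) - \<rho> / 2 * (norm (y - u))\<^sup>2"
proof -
  define d where "d = (norm (y - u))\<^sup>2"
  define w where "w = inner \<zeta> (y - u)"
  define a b where "a = real_of_ereal (g u)" and "b = real_of_ereal (g y)"
  have ue: "u \<in> edom g" using \<zeta> unfolding prox_subdiff_def by blast
  obtain \<sigma> \<eta> where \<sigma>: "\<sigma> > 0" "\<eta> > 0" and local:
    "\<And>x. x \<in> ball u \<eta> \<Longrightarrow> x \<in> edom g \<Longrightarrow>
      real_of_ereal (g x) \<ge> a + inner \<zeta> (x - u) - \<sigma> * (norm (x - u))\<^sup>2"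
    using prox_subdiffE[OF \<zeta> nm] unfolding a_def by blast
  \<comment> \<open>The proximal error at the combination is
    \<open>\<sigma> * t\<^sup>2 * d\<close>, so after division by \<open>t\<close> it still vanishes
    as \<open>t\<close> tends to 0.\<close>
  have key: "b - a \<ge> w - \<rho> / 2 * (1 - t) * d - \<sigma> * t * d"
    if t: "0 < t" "t < 1" "t * norm (y - u) < \<eta>" for t
  proof -
    let ?z = "(1 - t) *\<^sub>R u + t *\<^sub>R y"
    have zu: "?z - u = t *\<^sub>R (y - u)"
      by (simp add: algebra_simps)
    have "norm (?z - u) < \<eta>"
      using t unfolding zu by simp
    then have "?z \<in> ball u \<eta>"
      by (metis dist_norm dist_commute mem_ball)
    then have "a + inner \<zeta> (?z - u) - \<sigma> * (norm (?z - u))\<^sup>2 \<le> real_of_ereal (g ?z)"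
      using local semi_convex_combination(1)[OF cvx nm u ue y, of t] t by simp
    also have "\<dots> \<le> (1 - t) * a + t * b + \<rho> / 2 * (t * (1 - t) * d)"
      using semi_convex_combination(2)[OF cvx nm u ue y, of t] t
      by (simp add: a_def b_def d_def)
    finally have "t * (w - \<rho> / 2 * (1 - t) * d - \<sigma> * t * d) \<le> t * (b - a)"
      unfolding zu norm_scaleR power_mult_distrib inner_scaleR_right d_def[symmetric] w_def[symmetric]
      by (simp add: algebra_simps diff_divide_distrib power2_eq_square)
    then show ?thesis using t by simp
  qed
  have "((\<lambda>t. t * norm (y - u)) \<longlongrightarrow> 0 * norm (y - u)) (at_right 0)"
    by (intro tendsto_intros)
  then have "eventually (\<lambda>t. t * norm (y - u) < \<eta>) (at_right 0)"
    using \<sigma> by (intro order_tendstoD) auto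
  moreover have "eventually (\<lambda>t. 0 < t \<and> t < (1::real)) (at_right 0)"
    unfolding eventually_at_right_field by (auto intro: exI[of _ 1])
  ultimately have ev: "eventually (\<lambda>t. w - \<rho> / 2 * (1 - t) * d - \<sigma> * t * d \<le> b - a) (at_right 0)"
    by eventually_elim (use key in auto)
  have "((\<lambda>t. w - \<rho> / 2 * (1 - t) * d - \<sigma> * t * d) \<longlongrightarrow>
      w - \<rho> / 2 * (1 - 0) * d - \<sigma> * 0 * d) (at_right 0)"
    by (intro tendsto_intros)
  from tendsto_upperbound[OF this ev] show ?thesis
    by (simp add: a_def b_def w_def d_def)
qed

text \<open>Subtracting the linearization of \<open>f\<close> from the proximal inequality of the
  sum costs a quadratic term, absorbed by enlarging \<open>\<sigma>\<close> to
  \<open>\<sigma> + L\<close>. The linearization is required only on \<open>edom g\<close>, because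
  elsewhere \<open>g\<close> is infinite and the inequality for \<open>g\<close> is trivial.\<close>

lemma prox_subdiff_add_smooth:
  fixes f g :: "'a::real_inner \<Rightarrow> ereal"
  assumes \<xi>: "\<xi> \<in> prox_subdiff (\<lambda>x. f x + g x) u"
    and nm: "\<And>x. f x \<noteq> -\<infinity>" "\<And>x. g x \<noteq> -\<infinity>"
    and S: "open S" "u \<in> S" "S \<subseteq> edom f" and "L \<ge> 0"
    and lin: "\<And>y. y \<in> S \<Longrightarrow> y \<in> edom g \<Longrightarrow>
      \<bar>real_of_ereal (f y) - real_of_ereal (f u) - inner v (y - u)\<bar> \<le> L * (norm (y - u))\<^sup>2"
  shows "\<xi> - v \<in> prox_subdiff g u"
proof -
  let ?F = "\<lambda>x. f x + g x"
  have nmF: "?F x \<noteq> -\<infinity>" for x using nm[of x] by simp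
  have u: "u \<in> edom f" "u \<in> edom g"
    using \<xi> edom_add[of f g, OF nm] unfolding prox_subdiff_def by auto
  obtain \<sigma> \<eta> where \<sigma>: "\<sigma> > 0" "\<eta> > 0" and local:
    "\<And>x. x \<in> ball u \<eta> \<Longrightarrow> x \<in> edom ?F \<Longrightarrow> real_of_ereal (?F x)
      \<ge> real_of_ereal (?F u) + inner \<xi> (x - u) - \<sigma> * (norm (x - u))\<^sup>2"
    using prox_subdiffE[OF \<xi> nmF] by blast
  obtain e where e: "e > 0" "ball u e \<subseteq> S"
    using S openE by blast
  have "g x \<ge> g u + ereal (inner (\<xi> - v) (x - u) - (\<sigma> + L) * (norm (x - u))\<^sup>2)"
    if x: "x \<in> ball u (min \<eta> e)" for x
  proof (cases "x \<in> edom g")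
    case True
    have xS: "x \<in> S" "x \<in> edom f" using x e S by auto
    have "real_of_ereal (f x) + real_of_ereal (g x) \<ge> real_of_ereal (f u) + real_of_ereal (g u)
        + inner \<xi> (x - u) - \<sigma> * (norm (x - u))\<^sup>2"
      using local[of x] x True xS edom_add[of f g, OF nm] u
      by (simp add: real_of_ereal_add_edom nm)
    moreover have "real_of_ereal (f x) - real_of_ereal (f u) \<le> inner v (x - u) + L * (norm (x - u))\<^sup>2"
      using lin[OF xS(1) True] by linarith
    ultimately have "real_of_ereal (g x) \<ge> real_of_ereal (g u)
        + (inner (\<xi> - v) (x - u) - (\<sigma> + L) * (norm (x - u))\<^sup>2)"
      by (simp add: inner_diff_left algebra_simps)
    then have "ereal (real_of_ereal (g x)) \<ge> ereal (real_of_ereal (g u))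
        + ereal (inner (\<xi> - v) (x - u) - (\<sigma> + L) * (norm (x - u))\<^sup>2)"
      by simp
    then show ?thesis
      using edom_ereal_real[of g, OF nm(2)] True u(2) by metis
  next
    case False
    then show ?thesis by (simp add: edom_def)
  qed
  then show ?thesis
    unfolding prox_subdiff_def mem_Collect_eq using \<sigma> e \<open>L \<ge> 0\<close> u
    by (intro conjI exI[of _ "\<sigma> + L"] exI[of _ "min \<eta> e"]) auto
qed

section \<open>From quadratic bounds to the KL inequality, and calmness with balls\<close>

lemma KL_halfI:
  fixes \<phi> :: "'a::real_inner \<Rightarrow> ereal"
  assumes nm: "\<And>x. \<phi> x \<noteq> -\<infinity>" and xb: "xb \<in> edom \<phi>" and "M > 0" "r > 0"
    and bound: "\<And>x \<xi>. x \<in> ball xb r \<Longrightarrow> \<xi> \<in> prox_subdiff \<phi> x \<Longrightarrow>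
      real_of_ereal (\<phi> x) - real_of_ereal (\<phi> xb) \<le> M * (norm \<xi>)\<^sup>2"
  shows "KL_half \<phi> xb"
proof -
  \<comment> \<open>Limiting subgradients come with convergence of function values as well as of
    points and subgradients, so both sides of the bound pass to the limit; openness of the ball puts
    the approximating points inside it eventually.\<close>
  have lim: "real_of_ereal (\<phi> x) - real_of_ereal (\<phi> xb) \<le> M * (norm \<xi>)\<^sup>2"
    if x: "x \<in> ball xb r" and \<xi>: "\<xi> \<in> lim_subdiff \<phi> x" for x \<xi>
  proof -
    obtain X \<Xi> where X: "X \<longlonglongrightarrow> x" "(\<lambda>k. \<phi> (X k)) \<longlonglongrightarrow> \<phi> x" "\<Xi> \<longlonglongrightarrow> \<xi>"
      and \<Xi>: "\<And>k::nat. \<Xi> k \<in> prox_subdiff \<phi> (X k)" and xe: "x \<in> edom \<phi>"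
      using \<xi> unfolding lim_subdiff_def by blast
    have "(\<lambda>k. \<phi> (X k)) \<longlonglongrightarrow> ereal (real_of_ereal (\<phi> x))"
      using X(2) unfolding edom_ereal_real[of \<phi>, OF nm xe, symmetric] .
    then have "(\<lambda>k. real_of_ereal (\<phi> (X k))) \<longlonglongrightarrow> real_of_ereal (\<phi> x)"
      by (rule lim_real_of_ereal)
    then have "(\<lambda>k. real_of_ereal (\<phi> (X k)) - real_of_ereal (\<phi> xb))
        \<longlonglongrightarrow> real_of_ereal (\<phi> x) - real_of_ereal (\<phi> xb)"
      by (rule tendsto_diff[OF _ tendsto_const])
    moreover have "(\<lambda>k. M * (norm (\<Xi> k))\<^sup>2) \<longlonglongrightarrow> M * (norm \<xi>)\<^sup>2"
      using X(3) by (intro tendsto_intros)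
    moreover have "eventually (\<lambda>k. X k \<in> ball xb r) sequentially"
      using X(1) x by (intro topological_tendstoD) auto
    then have "eventually (\<lambda>k. real_of_ereal (\<phi> (X k)) - real_of_ereal (\<phi> xb)
        \<le> M * (norm (\<Xi> k))\<^sup>2) sequentially"
      by eventually_elim (use bound \<Xi> in blast)
    ultimately show ?thesis
      using tendsto_le[OF sequentially_bot] by blast
  qed
  have "ereal (sqrt M * real_of_ereal (\<phi> x - \<phi> xb) powr (- 1 / 2)) * einfdist 0 (lim_subdiff \<phi> x) \<ge> 1"
    if x: "x \<in> ball xb r" "\<phi> xb < \<phi> x" "\<phi> x < \<infinity>" for x
  proof -
    obtain a b where ab: "\<phi> x = ereal a" "\<phi> xb = ereal b"
      using edom_ereal_real[of \<phi>, OF nm] xb x(3) unfolding edom_def by blast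
    define d where "d = a - b"
    have d: "d > 0" using x(2) ab by (simp add: d_def)
    \<comment> \<open>The bound \<open>d \<le> M * (norm \<xi>)\<^sup>2\<close> solved for the norm.
      An empty subdifferential is covered too, its distance being infinite. The KL constant
      \<open>sqrt M\<close> is the one that makes the product with this lower bound exactly
      1.\<close>
    have "ereal (sqrt (d / M)) \<le> einfdist 0 (lim_subdiff \<phi> x)"
      unfolding einfdist_def
    proof (rule INF_greatest)
      fix \<xi> assume "\<xi> \<in> lim_subdiff \<phi> x"
      then have "d / M \<le> (norm \<xi>)\<^sup>2"
        using lim[OF x(1)] \<open>M > 0\<close> by (simp add: ab d_def pos_divide_le_eq mult.commute)
      then have "sqrt (d / M) \<le> norm \<xi>"
        by (simp add: real_le_lsqrt)
      then show "ereal (sqrt (d / M)) \<le> ereal (dist 0 \<xi>)" by simp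
    qed
    then have "ereal (sqrt M * d powr (- 1 / 2)) * ereal (sqrt (d / M))
        \<le> ereal (sqrt M * d powr (- 1 / 2)) * einfdist 0 (lim_subdiff \<phi> x)"
      using \<open>M > 0\<close> by (intro ereal_mult_left_mono) auto
    moreover have "sqrt M * d powr (- 1 / 2) * sqrt (d / M) = 1"
      using d \<open>M > 0\<close> by (simp add: powr_minus powr_half_sqrt real_sqrt_divide field_simps)
    ultimately show ?thesis
      by (simp add: ab d_def one_ereal_def)
  qed
  then show ?thesis
    unfolding KL_half_def using xb \<open>M > 0\<close> \<open>r > 0\<close>
    by (intro conjI exI[of _ "sqrt M"] exI[of _ r]) auto
qed

lemma calm_atD:
  assumes "calm_at S pb xb"
  obtains \<kappa> \<delta> r where "\<kappa> \<ge> 0" "\<delta> > 0" "r > 0"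
    "\<And>p x. p \<in> ball pb \<delta> \<Longrightarrow> x \<in> ball xb r \<Longrightarrow> x \<in> S p \<Longrightarrow>
      \<exists>z\<in>S pb. norm (x - z) \<le> \<kappa> * norm (p - pb)"
proof -
  obtain U V \<kappa> where \<kappa>: "\<kappa> \<ge> 0" and UV: "open U" "pb \<in> U" "open V" "xb \<in> V"
    and sub: "\<And>p. p \<in> U \<Longrightarrow> S p \<inter> V \<subseteq> S pb + (\<lambda>b. (\<kappa> * norm (p - pb)) *\<^sub>R b) ` cball 0 1"
    using assms unfolding calm_at_def by blast
  obtain \<delta> r where \<delta>: "\<delta> > 0" "ball pb \<delta> \<subseteq> U" and r: "r > 0" "ball xb r \<subseteq> V"
    using UV openE by metis
  have "\<exists>z\<in>S pb. norm (x - z) \<le> \<kappa> * norm (p - pb)"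
    if "p \<in> ball pb \<delta>" "x \<in> ball xb r" "x \<in> S p" for p x
  proof -
    have "x \<in> S pb + (\<lambda>b. (\<kappa> * norm (p - pb)) *\<^sub>R b) ` cball 0 1"
      using sub[of p] \<delta> r that by blast
    then obtain z b where "z \<in> S pb" "norm b \<le> 1" "x = z + (\<kappa> * norm (p - pb)) *\<^sub>R b"
      by (auto elim!: set_plus_elim)
    then show ?thesis
      using \<kappa> by (intro bexI[of _ z]) (auto simp: abs_mult mult_left_le)
  qed
  with \<kappa> \<delta>(1) r(1) that show ?thesis by blast
qed

section \<open>The KL property from calmness and proper separation\<close>

theorem theorem4p3:
  fixes f g :: "real ^ 'n \<Rightarrow> ereal" and C :: "(real ^ 'n) set"
    and L Fmin :: real and xbar :: "real ^ 'n"
  assumes "proper f" and "lsc f" and "proper g" and "lsc g"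
    and "smooth_on_edom f"
    and "L > 0" and "closed C" and "edom f \<inter> edom g \<subseteq> C"
    and "L-lipschitz_on (C \<inter> edom f) (grad f)"
    and "continuous_on (edom g) g"
    and "\<forall>x. f x + g x \<ge> ereal Fmin"
    and "prox_bounded g"
    and "xbar \<in> prox_stationary f g"
    and "semi_convex_around g xbar"
    and "proper_separation f g xbar"
    and "calm_at (S_cano f g) 0 xbar"
  shows "KL_half (\<lambda>x. f x + g x) xbar"
proof -
  let ?F = "\<lambda>x. f x + g x"
  define fr gr where "fr = (\<lambda>x. real_of_ereal (f x))" and "gr = (\<lambda>x. real_of_ereal (g x))"
  have nm: "\<And>x. f x \<noteq> -\<infinity>" "\<And>x. g x \<noteq> -\<infinity>"
    using assms(1,3) unfolding proper_def by auto
  have nmF: "?F x \<noteq> -\<infinity>" for x using nm[of x] by simp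
  have S0: "S_cano f g 0 = prox_stationary f g"
    unfolding S_cano_def prox_stationary_def ..
  have stat_edom: "z \<in> edom f \<and> z \<in> edom g" if "z \<in> prox_stationary f g" for z
    using that unfolding prox_stationary_def elt_set_plus_def prox_subdiff_def by auto
  have xb: "xbar \<in> edom f" "xbar \<in> edom g"
    using stat_edom assms(13) by auto
  obtain \<rho> \<eta> where \<rho>: "\<rho> > 0" "\<eta> > 0"
    and cvx\<eta>: "ereal_convex_on (ball xbar \<eta>) (\<lambda>x. g x + ereal (\<rho> / 2 * (norm x)\<^sup>2))"
    using assms(14) unfolding semi_convex_around_def by blast
  obtain \<epsilon>1 where \<epsilon>1: "\<epsilon>1 > 0" and
    sep: "\<And>x. x \<in> prox_stationary f g \<Longrightarrow> x \<in> ball xbar \<epsilon>1 \<Longrightarrow> ?F x = ?F xbar"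
    using assms(15) unfolding proper_separation_def by blast
  obtain \<epsilon>2 where \<epsilon>2: "\<epsilon>2 > 0" "ball xbar \<epsilon>2 \<subseteq> edom f"
    using assms(5) xb openE unfolding smooth_on_edom_def by metis
  obtain \<kappa> \<delta>0 r0 where \<kappa>: "\<kappa> \<ge> 0" and \<delta>0: "\<delta>0 > 0" and r0: "r0 > 0"
    and calm: "\<And>p x. p \<in> ball 0 \<delta>0 \<Longrightarrow> x \<in> ball xbar r0 \<Longrightarrow> x \<in> S_cano f g p \<Longrightarrow>
      \<exists>z\<in>prox_stationary f g. norm (x - z) \<le> \<kappa> * norm p"
    using calm_atD[OF assms(16)] unfolding S0 by (metis diff_zero)
  \<comment> \<open>One radius for semi-convexity of \<open>g\<close>, separation of stationary
    values and finiteness of \<open>f\<close>.\<close>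
  define R where "R = min \<eta> (min \<epsilon>1 \<epsilon>2)"
  have R: "R > 0" "R \<le> \<eta>" "R \<le> \<epsilon>1" "R \<le> \<epsilon>2"
    using \<rho> \<epsilon>1 \<epsilon>2 by (auto simp: R_def)
  let ?B = "ball xbar R"
  have Bf: "?B \<subseteq> edom f" using R \<epsilon>2 by auto
  have cvx: "ereal_convex_on ?B (\<lambda>x. g x + ereal (\<rho> / 2 * (norm x)\<^sup>2))"
    using cvx\<eta> subset_ball[OF R(2), of xbar] unfolding ereal_convex_on_def by (auto simp: subset_iff)

  \<comment> \<open>Semi-convexity keeps the segment in \<open>edom g\<close>, hence in
    \<open>C\<close>, where the gradient is Lipschitz.\<close>
  have lin: "\<bar>fr b - fr a - inner (grad f a) (b - a)\<bar> \<le> L * (norm (b - a))\<^sup>2"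
    if "a \<in> ?B" "a \<in> edom g" "b \<in> ?B" "b \<in> edom g" for a b
  proof (rule lipschitz_gradient_linearization)
    have segg: "closed_segment a b \<subseteq> edom g"
      using semi_convex_combination(1)[OF cvx nm(2)] that by (auto simp: in_segment)
    have segB: "closed_segment a b \<subseteq> ?B"
      using that by (intro closed_segment_subset) auto
    show "GDERIV fr x :> grad f x" if "x \<in> closed_segment a b" for x
      using GDERIV_grad[OF assms(5)] that segB Bf unfolding fr_def by blast
    show "L-lipschitz_on (closed_segment a b) (grad f)"
      using lipschitz_on_subset[OF assms(9)] segg segB Bf assms(8) by blast
  qed

  define K where "K = \<rho> / 2 + L"
  have K: "K > 0" using \<rho> assms(6) by (simp add: K_def)
  have sub: "\<xi> - grad f x \<in> prox_subdiff g x" "x \<in> edom g"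
    if x: "x \<in> ?B" and \<xi>: "\<xi> \<in> prox_subdiff ?F x" for x \<xi>
  proof -
    show xg: "x \<in> edom g"
      using \<xi> edom_add[of f g, OF nm] unfolding prox_subdiff_def by auto
    show "\<xi> - grad f x \<in> prox_subdiff g x"
      using lin[OF x xg] assms(6)
      by (intro prox_subdiff_add_smooth[OF \<xi> nm open_ball x Bf, of L]) (auto simp: fr_def)
  qed
  \<comment> \<open>The lower bounds for \<open>g\<close> and \<open>f\<close> at \<open>z\<close>
    are added: the inner products with \<open>grad f x\<close> cancel, and the two quadratic errors
    sum to \<open>K\<close>, which depends neither on \<open>x\<close> nor on
    \<open>\<xi>\<close>.\<close>
  have ineq: "fr x + gr x - (fr z + gr z) \<le> norm \<xi> * norm (x - z) + K * (norm (x - z))\<^sup>2"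
    if x: "x \<in> ?B" and \<xi>: "\<xi> \<in> prox_subdiff ?F x" and z: "z \<in> ?B" "z \<in> edom g" for x \<xi> z
  proof -
    have "gr z \<ge> gr x + inner (\<xi> - grad f x) (z - x) - \<rho> / 2 * (norm (z - x))\<^sup>2"
      unfolding gr_def
      using semi_convex_prox_subgradient[OF cvx nm(2) x sub(1)[OF x \<xi>] z] .
    moreover have "fr z - fr x - inner (grad f x) (z - x) \<ge> - (L * (norm (z - x))\<^sup>2)"
      using lin[OF x sub(2)[OF x \<xi>] z] by linarith
    moreover have "- inner \<xi> (z - x) \<le> norm \<xi> * norm (z - x)"
      using Cauchy_Schwarz_ineq2[of \<xi> "z - x"] by linarith
    ultimately show ?thesis
      by (simp add: inner_diff_left K_def norm_minus_commute[of x z] algebra_simps)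
  qed

  \<comment> \<open>Half of \<open>R\<close> is kept for the distance from \<open>xbar\<close> to
    \<open>x\<close>, and \<open>\<delta>\<close> makes \<open>\<kappa> * norm \<xi>\<close> at most
    the other half, so the point given by calmness stays in the ball. The summand 1 in
    \<open>\<kappa> + 1\<close> guards against \<open>\<kappa> = 0\<close>.\<close>
  define r where "r = min r0 (R / 2)"
  define \<delta> where "\<delta> = min \<delta>0 (R / (2 * (\<kappa> + 1)))"
  have r: "r > 0" "r \<le> r0" "r \<le> R / 2" using r0 R by (auto simp: r_def)
  have \<delta>: "\<delta> > 0" "\<delta> \<le> \<delta>0" "\<delta> \<le> R / (2 * (\<kappa> + 1))" using \<delta>0 R \<kappa> by (auto simp: \<delta>_def)
  \<comment> \<open>\<open>\<kappa>\<close> serves small subgradients, \<open>r / \<delta>\<close>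
    the remaining ones.\<close>
  define c where "c = max \<kappa> (r / \<delta>)"
  have c: "c > 0" "c \<ge> \<kappa>" "c \<ge> r / \<delta>" using r \<delta> by (auto simp: c_def less_max_iff_disj)

  have near: "\<exists>z\<in>prox_stationary f g. z \<in> ?B \<and> norm (x - z) \<le> c * norm \<xi>"
    if x: "x \<in> ball xbar r" and \<xi>: "\<xi> \<in> prox_subdiff ?F x" for x \<xi>
  proof (cases "norm \<xi> < \<delta>")
    case True
    have xB: "x \<in> ?B" using x r R by auto
    \<comment> \<open>The subgradient itself is the perturbation parameter: \<open>\<xi>\<close> is
      \<open>grad f x\<close> plus the proximal subgradient \<open>\<xi> - grad f x\<close> of
      \<open>g\<close>.\<close>
    have "x \<in> S_cano f g \<xi>"
      using sub(1)[OF xB \<xi>] xB Bf unfolding S_cano_def elt_set_plus_def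
      by (auto intro!: bexI[of _ "\<xi> - grad f x"])
    then obtain z where z: "z \<in> prox_stationary f g" "norm (x - z) \<le> \<kappa> * norm \<xi>"
      using calm[of \<xi> x] True \<delta> x r by auto
    have "\<kappa> * norm \<xi> \<le> (\<kappa> + 1) * \<delta>"
      using True \<kappa> by (intro mult_mono) auto
    also have "\<dots> \<le> R / 2"
      using \<delta>(3) \<kappa> by (simp add: pos_le_divide_eq algebra_simps)
    finally have "dist x z \<le> R / 2" using z by (simp add: dist_norm)
    then have "z \<in> ?B"
      using x r dist_triangle[of xbar z x] by auto
    moreover have "\<kappa> * norm \<xi> \<le> c * norm \<xi>"
      using c by (intro mult_right_mono) auto
    ultimately show ?thesis using z by auto
  next
    case False
    \<comment> \<open>Here \<open>norm \<xi>\<close> is at least \<open>\<delta>\<close>, so the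
      fixed distance bound \<open>r\<close> is already a multiple of it and \<open>xbar\<close>
      serves as the stationary point.\<close>
    have "norm (x - xbar) \<le> r"
      using x by (simp add: dist_norm norm_minus_commute)
    also have "\<dots> = r / \<delta> * \<delta>" using \<delta> by simp
    also have "\<dots> \<le> c * norm \<xi>"
      using False c \<delta> r by (intro mult_mono) auto
    finally show ?thesis using assms(13) R by (intro bexI[of _ xbar]) auto
  qed

  show ?thesis
  proof (rule KL_halfI[where \<phi> = ?F, OF nmF])
    show "xbar \<in> edom ?F" using edom_add[of f g, OF nm] xb by simp
    \<comment> \<open>This constant results from inserting
      \<open>norm (x - z) \<le> c * norm \<xi>\<close> into \<open>ineq\<close>: the linear term
      contributes \<open>c\<close>, the quadratic one \<open>K * c\<^sup>2\<close>.\<close>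
    show "c + K * c\<^sup>2 > 0" using c K by (simp add: add_pos_pos)
    show "r > 0" by (fact r)
    fix x \<xi> assume x: "x \<in> ball xbar r" and \<xi>: "\<xi> \<in> prox_subdiff ?F x"
    obtain z where z: "z \<in> prox_stationary f g" "z \<in> ?B" "norm (x - z) \<le> c * norm \<xi>"
      using near[OF x \<xi>] by blast
    have ze: "z \<in> edom f" "z \<in> edom g" using stat_edom z by auto
    have xB: "x \<in> ?B" using x r R by auto
    have "?F z = ?F xbar" using sep z R by auto
    then have Fz: "fr z + gr z = real_of_ereal (?F xbar)"
      using real_of_ereal_add_edom[of f g, OF nm ze] by (simp add: fr_def gr_def)
    have "fr x + gr x = real_of_ereal (?F x)"
      using real_of_ereal_add_edom[of f g x, OF nm] sub(2)[OF xB \<xi>] xB Bf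
      by (auto simp: fr_def gr_def)
    then have "real_of_ereal (?F x) - real_of_ereal (?F xbar)
        \<le> norm \<xi> * norm (x - z) + K * (norm (x - z))\<^sup>2"
      using ineq[OF xB \<xi> z(2) ze(2)] Fz by simp
    also have "\<dots> \<le> norm \<xi> * (c * norm \<xi>) + K * (c * norm \<xi>)\<^sup>2"
      using z(3) K by (intro add_mono mult_left_mono power_mono) auto
    also have "\<dots> = (c + K * c\<^sup>2) * (norm \<xi>)\<^sup>2"
      by (simp add: power2_eq_square algebra_simps)
    finally show "real_of_ereal (?F x) - real_of_ereal (?F xbar) \<le> (c + K * c\<^sup>2) * (norm \<xi>)\<^sup>2" .
  qed
qed

end
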